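(* For integers $n,i,j\ge0$ and $m\in\{1,2\}$, $D^{\mathrm{I}}_m(i,j,n)=D^{\mathrm{II}}_m(i,j,n)$, where $D^{\mathrm{I}}_m(i,j,n)$ is the number of partitions of $n$ into distinct parts $\not\equiv -m\pmod3$ having exactly $i$ odd-indexed parts $\equiv m\pmod 3$ and exactly $j$ even-indexed parts $\equiv m\pmod3$, and $D^{\mathrm{II}}_m(i,j,n)$ is the number of partitions of $n$ into distinct parts $\not\equiv-m\pmod3$ having exactly $i$ parts $\equiv m\pmod6$ and exactly $j$ parts $\equiv m+3\pmod6$.
   Context: For a partition $\pi=(\pi_1>\pi_2>\cdots)$, the odd-indexed parts are $\pi_1,\pi_3,\dots$ and the even-indexed parts are $\pi_2,\pi_4,\dots$. *)

theory Defs
  imports "HOL-Number_Theory.Cong"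
begin

definition distinct_partition :: "nat \<Rightarrow> nat list \<Rightarrow> bool" where
  "distinct_partition n p \<longleftrightarrow>
     sorted_wrt (>) p \<and> (\<forall>x\<in>set p. x > 0) \<and> sum_list p = n"

text \<open>
  Parts are indexed from 1, as in \<open>\<pi>\<^sub>1 > \<pi>\<^sub>2 > \<dots>\<close>, whereas list positions start at 0.
\<close>

definition part :: "nat list \<Rightarrow> nat \<Rightarrow> nat" where
  "part p k = p ! (k - 1)"

definition avoiding_partitions :: "nat \<Rightarrow> nat \<Rightarrow> nat list set" where
  "avoiding_partitions m n =
     {p. distinct_partition n p \<and> (\<forall>x\<in>set p. \<not> [int x = - int m] (mod 3))}"

definition D_I :: "nat \<Rightarrow> nat \<Rightarrow> nat \<Rightarrow> nat \<Rightarrow> nat" where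
  "D_I m i j n = card {p \<in> avoiding_partitions m n.
     card {k \<in> {1..length p}. odd k \<and> [part p k = m] (mod 3)} = i \<and>
     card {k \<in> {1..length p}. even k \<and> [part p k = m] (mod 3)} = j}"

definition D_II :: "nat \<Rightarrow> nat \<Rightarrow> nat \<Rightarrow> nat \<Rightarrow> nat" where
  "D_II m i j n = card {p \<in> avoiding_partitions m n.
     card {k \<in> {1..length p}. [part p k = m] (mod 6)} = i \<and>
     card {k \<in> {1..length p}. [part p k = m + 3] (mod 6)} = j}"

text \<open>The sets counted above are finite, so their \<open>card\<close> is the actual number of elements.\<close>

lemma finite_avoiding_partitions: "finite (avoiding_partitions m n)"
proof (rule finite_subset)
  show "avoiding_partitions m n \<subseteq> {p. set p \<subseteq> {..n} \<and> length p \<le> n}"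
  proof
    fix p assume "p \<in> avoiding_partitions m n"
    then have pos: "\<forall>x\<in>set p. x > 0" and n: "sum_list p = n"
      by (auto simp: avoiding_partitions_def distinct_partition_def)
    have "length p \<le> sum_list p"
      using pos by (induction p) auto
    then show "p \<in> {p. set p \<subseteq> {..n} \<and> length p \<le> n}"
      using n member_le_sum_list by fastforce
  qed
  show "finite {p. set p \<subseteq> {..n} \<and> length p \<le> n}"
    by (rule finite_lists_length_le) simp
qed

end

theory Submission
  imports Defs "HOL-Computational_Algebra.Formal_Power_Series"
begin

text \<open>
  Truncate to parts of size at most \<open>3N\<close> and put \<open>q = X\<^sup>3\<close>, \<open>t = X\<^sup>m\<close>. Building partitions by
  adding new largest parts, each of which exchanges odd and even positions, both generating
  functions satisfy a recursion in \<open>N\<close>. Both recursions have explicit solutions: multiplied by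
  \<open>(q\<^sup>2;q\<^sup>2)\<^sub>i (q\<^sup>2;q\<^sup>2)\<^sub>j\<close>, each solution is
  \<open>t^(i + j) q^(i\<^sup>2 - i + j\<^sup>2) (-q;q)\<^sub>N\<close> times a product of at most \<open>i + j\<close>
  factors \<open>1 - q^k\<close> with \<open>k\<close> growing with \<open>N\<close>. These last factors are the only
  difference and do not affect the coefficient of \<open>X^n\<close> once \<open>N\<close> is large.
\<close>

section \<open>Finite q-products\<close>

definition q_poch :: "'a::comm_ring_1 \<Rightarrow> nat \<Rightarrow> 'a" where
  "q_poch q n = (\<Prod>k<n. 1 - q ^ Suc k)"

definition q_poch_neg :: "'a::comm_ring_1 \<Rightarrow> nat \<Rightarrow> 'a" where
  "q_poch_neg q n = (\<Prod>k<n. 1 + q ^ Suc k)"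

text \<open>
  The product vanishes for \<open>r > n\<close>: the factor at \<open>k = n\<close> is \<open>1 - q ^ 0\<close>.
\<close>

definition q_falling :: "'a::comm_ring_1 \<Rightarrow> nat \<Rightarrow> nat \<Rightarrow> 'a" where
  "q_falling q n r = (\<Prod>k<r. 1 - q ^ (n - k))"

lemma q_poch_simps [simp]: "q_poch q 0 = 1" "q_poch q (Suc n) = q_poch q n * (1 - q ^ Suc n)"
  by (simp_all add: q_poch_def)

lemma q_poch_square_Suc: "q_poch (q^2) (Suc n) = q_poch (q^2) n * (1 - q ^ (2 * Suc n))"
  by (simp only: q_poch_simps power_mult)

lemma q_poch_neg_simps [simp]:
  "q_poch_neg q 0 = 1" "q_poch_neg q (Suc n) = q_poch_neg q n * (1 + q ^ Suc n)"
  by (simp_all add: q_poch_neg_def)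

lemma q_falling_0 [simp]: "q_falling q n 0 = 1"
  by (simp add: q_falling_def)

lemma q_falling_Suc: "q_falling q n (Suc r) = q_falling q n r * (1 - q ^ (n - r))"
  by (simp add: q_falling_def)

lemma q_falling_Suc_Suc: "q_falling q (Suc n) (Suc r) = (1 - q ^ Suc n) * q_falling q n r"
  by (simp add: q_falling_def prod.lessThan_Suc_shift del: prod.lessThan_Suc)

lemma q_falling_eq_0: "n < r \<Longrightarrow> q_falling q n r = 0"
  by (auto simp: q_falling_def intro!: prod_zero bexI[of _ n])

text \<open>Every factor is 1 modulo \<open>d\<close>. With \<open>d\<close> a power of X this
  discards the factors that depend on the truncation.\<close>

lemma q_falling_cong_1:
  fixes q :: "'a::comm_ring_1"
  assumes "\<And>k. k < r \<Longrightarrow> d dvd q ^ (n - k)"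
  shows "d dvd q_falling q n r - 1"
  using assms
proof (induction r)
  case (Suc r)
  have "q_falling q n (Suc r) - 1 = (q_falling q n r - 1) - q_falling q n r * q ^ (n - r)"
    by (simp add: q_falling_Suc algebra_simps)
  then show ?case using Suc by (simp only: dvd_diff dvd_mult less_SucI lessI)
qed simp

text \<open>
  The weight \<open>i\<^sup>2 - i + j\<^sup>2\<close>, with the truncated subtraction written so that it is exact.
\<close>

definition wt :: "nat \<Rightarrow> nat \<Rightarrow> nat" where
  "wt i j = i * (i - 1) + j * j"

section \<open>Closed forms of the two recursions\<close>

text \<open>The four terms of \<open>step\<close> stand for adding nothing, the part 3N+m, the part
  3N+3, or both. Each new part interchanges \<open>i\<close> and \<open>j\<close>; when both are
  added, 3N+m lands in position 2. Under the induction hypothesis the four terms telescope.\<close>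

lemma alternating_closed_form:
  fixes P :: "nat \<Rightarrow> nat \<Rightarrow> nat \<Rightarrow> 'a::comm_ring_1"
  assumes init: "\<And>i j. P 0 i j = (if i = 0 \<and> j = 0 then 1 else 0)"
    and step: "\<And>N i j. P (Suc N) i j = P N i j + t * q ^ N * (if i = 0 then 0 else P N j (i - 1))
       + q ^ Suc N * (P N j i + t * q ^ N * (if j = 0 then 0 else P N i (j - 1)))"
  shows "P N i j * (q_poch (q^2) i * q_poch (q^2) j)
           = t ^ (i + j) * q ^ wt i j * q_poch_neg q N * q_falling q N (i + j)"
proof (induction N arbitrary: i j)
  case 0
  then show ?case by (cases "i + j") (auto simp: init wt_def q_falling_eq_0)
next
  case (Suc N)
  let ?A = "q_poch (q^2) i * q_poch (q^2) j"
  show ?case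
  proof (cases "i + j = 0")
    case True
    then show ?thesis using Suc[of 0 0] by (simp add: step wt_def algebra_simps)
  next
    case False
    then obtain s where s: "i + j = Suc s" by (cases "i + j") auto
    \<comment> \<open>\<open>F\<close> is what the four terms share; beyond it only powers of
      \<open>q\<close> remain.\<close>
    define F where "F = t ^ Suc s * q_poch_neg q N * q_falling q N s"
    have a: "P N i j * ?A = F * (q ^ wt i j * (1 - q ^ (N - s)))"
      by (simp add: Suc s F_def q_falling_Suc algebra_simps)
    have b: "P N j i * ?A = F * (q ^ wt j i * (1 - q ^ (N - s)))"
      using Suc[of j i] s by (simp add: F_def q_falling_Suc algebra_simps)
    \<comment> \<open>Lowering \<open>i\<close> leaves the last factor 1 - q^(2i) of its denominator
      uncancelled. It vanishes at \<open>i = 0\<close>, so one formula also covers the absent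
      term.\<close>
    have c: "t * (if i = 0 then 0 else P N j (i - 1)) * ?A
               = F * (q ^ wt j (i - 1) * (1 - q ^ (2 * i)))"
    proof (cases i)
      case (Suc k)
      then have sk: "j + k = s" using s by simp
      have "t * P N j k * ?A
          = t * (P N j k * (q_poch (q^2) j * q_poch (q^2) k)) * (1 - q ^ (2 * Suc k))"
        by (simp only: Suc q_poch_square_Suc mult_ac)
      also have "\<dots> = F * (q ^ wt j k * (1 - q ^ (2 * Suc k)))"
        unfolding Suc.IH sk by (simp add: F_def mult_ac)
      finally show ?thesis by (simp add: Suc)
    qed simp
    have d: "t * (if j = 0 then 0 else P N i (j - 1)) * ?A
               = F * (q ^ wt i (j - 1) * (1 - q ^ (2 * j)))"
    proof (cases j)
      case (Suc k)
      then have sk: "i + k = s" using s by simp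
      have "t * P N i k * ?A
          = t * (P N i k * (q_poch (q^2) i * q_poch (q^2) k)) * (1 - q ^ (2 * Suc k))"
        by (simp only: Suc q_poch_square_Suc mult_ac)
      also have "\<dots> = F * (q ^ wt i k * (1 - q ^ (2 * Suc k)))"
        unfolding Suc.IH sk by (simp add: F_def mult_ac)
      finally show ?thesis by (simp add: Suc)
    qed simp
    have "P (Suc N) i j * ?A = P N i j * ?A
        + q ^ N * (t * (if i = 0 then 0 else P N j (i - 1)) * ?A)
        + q ^ Suc N * (P N j i * ?A)
        + q ^ (2 * N + 1) * (t * (if j = 0 then 0 else P N i (j - 1)) * ?A)"
      by (cases "i = 0"; cases "j = 0") (simp_all add: step algebra_simps power_add mult_2_right)
    also have "\<dots> = F * (q ^ wt i j * (1 - q ^ (N - s))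
        + q ^ N * (q ^ wt j (i - 1) * (1 - q ^ (2 * i)))
        + q ^ Suc N * (q ^ wt j i * (1 - q ^ (N - s)))
        + q ^ (2 * N + 1) * (q ^ wt i (j - 1) * (1 - q ^ (2 * j))))"
      unfolding a b c d by (simp add: algebra_simps)
    also have "\<dots> = F * (q ^ wt i j * (1 - q ^ (2 * Suc N)))"
    \<comment> \<open>With \<open>d = N - s\<close> and w = \<open>wt i j\<close>, the four summands
      are the successive differences of q^w, q^(w+d), q^(w+2i+d), q^(w+2i+2d), q^(w+2N+2). For
      \<open>s > N\<close> the factor \<open>F\<close> is zero.\<close>
    proof (cases "s \<le> N")
      case True
      then obtain d where N: "N = s + d" using le_Suc_ex by blast
      let ?w = "wt i j"
      have e1: "q ^ N * (q ^ wt j (i - 1) * (1 - q ^ (2 * i)))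
                 = q ^ (?w + d) - q ^ (?w + (2 * i + d))"
      proof (cases i)
        case (Suc k)
        then have "N + wt j (i - 1) = ?w + d"
          using s N by (cases j) (simp_all add: wt_def algebra_simps)
        then have "q ^ N * q ^ wt j (i - 1) = q ^ (?w + d)" by (metis power_add)
        then show ?thesis
          by (simp only: right_diff_distrib mult.assoc [symmetric]) (simp add: power_add mult_ac)
      qed simp
      have e2: "q ^ Suc N * (q ^ wt j i * (1 - q ^ (N - s)))
                 = q ^ (?w + (2 * i + d)) - q ^ (?w + (2 * i + d) + d)"
      proof -
        have "Suc N + wt j i = ?w + (2 * i + d)"
          using s N by (cases i; cases j) (simp_all add: wt_def algebra_simps)
        then have "q ^ Suc N * q ^ wt j i = q ^ (?w + (2 * i + d))" by (metis power_add)
        then show ?thesis unfolding N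
          by (simp only: right_diff_distrib mult.assoc [symmetric] mult_1_right add_diff_cancel_left')
            (simp only: power_add mult_ac)
      qed
      have e3: "q ^ (2 * N + 1) * (q ^ wt i (j - 1) * (1 - q ^ (2 * j)))
                 = q ^ (?w + (2 * i + d) + d) - q ^ (?w + 2 * Suc N)"
      proof (cases j)
        case 0
        then have "2 * i + d + d = 2 * Suc N" using s N by simp
        then show ?thesis using 0 by (simp add: add.assoc)
      next
        case (Suc k)
        then have "2 * N + 1 + wt i (j - 1) = ?w + (2 * i + d) + d"
          using s N by (simp add: wt_def algebra_simps)
        then have *: "q ^ (2 * N + 1) * q ^ wt i (j - 1) = q ^ (?w + (2 * i + d) + d)"
          by (metis power_add)
        have "?w + (2 * i + d) + d + 2 * j = ?w + 2 * Suc N" using s N by simp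
        then have "q ^ (?w + (2 * i + d) + d) * q ^ (2 * j) = q ^ (?w + 2 * Suc N)"
          by (metis power_add)
        with * show ?thesis by (simp only: right_diff_distrib mult.assoc [symmetric]) simp
      qed
      have e0: "q ^ ?w * (1 - q ^ (N - s)) = q ^ ?w - q ^ (?w + d)"
        by (simp add: N algebra_simps power_add)
      show ?thesis unfolding e0 e1 e2 e3 by (simp add: right_diff_distrib power_add)
    next
      case False
      then show ?thesis by (simp add: F_def q_falling_eq_0)
    qed
    \<comment> \<open>Since 1 - q^(2N+2) = (1 - q^(N+1)) (1 + q^(N+1)), one factor extends
      \<open>q_falling\<close> and the other \<open>q_poch_neg\<close>.\<close>
    also have "\<dots> = t ^ (i + j) * q ^ wt i j * q_poch_neg q (Suc N) * q_falling q (Suc N) (i + j)"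
      unfolding s q_falling_Suc_Suc
      by (simp add: F_def algebra_simps mult_2_right power_add)
    finally show ?thesis .
  qed
qed

text \<open>Without interchange the choices are independent. Selecting \<open>i\<close> of the
  powers q^0, q^2, ... gives q^(i(i-1)) times a Gaussian binomial in q^2; selecting \<open>j\<close>
  of q^1, q^3, ... gives q^(j^2) times another. Below \<open>N\<close> there are
  \<open>Suc N div 2\<close> even and \<open>N div 2\<close> odd exponents.\<close>

lemma residue_closed_form:
  fixes P :: "nat \<Rightarrow> nat \<Rightarrow> nat \<Rightarrow> 'a::comm_ring_1"
  assumes init: "\<And>i j. P 0 i j = (if i = 0 \<and> j = 0 then 1 else 0)"
    and step_even: "\<And>N i j. even N \<Longrightarrow> P (Suc N) i j
       = (1 + q ^ Suc N) * (P N i j + t * q ^ N * (if i = 0 then 0 else P N (i - 1) j))"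
    and step_odd: "\<And>N i j. odd N \<Longrightarrow> P (Suc N) i j
       = (1 + q ^ Suc N) * (P N i j + t * q ^ N * (if j = 0 then 0 else P N i (j - 1)))"
  shows "P N i j * (q_poch (q^2) i * q_poch (q^2) j)
           = t ^ (i + j) * q ^ wt i j * q_poch_neg q N
               * (q_falling (q^2) (Suc N div 2) i * q_falling (q^2) (N div 2) j)"
proof (induction N arbitrary: i j)
  case 0
  then show ?case by (cases "i = 0"; cases "j = 0") (auto simp: init wt_def q_falling_eq_0)
next
  case (Suc N)
  text \<open>The \<open>q\<close>-Pascal rule with denominators cleared.\<close>
  have pascal: "q ^ v * q_falling (q^2) L (Suc k) + q ^ u * ((1 - q ^ (2 * Suc k)) * q_falling (q^2) L k)
      = q ^ v * q_falling (q^2) (Suc L) (Suc k)" if "k \<le> L \<Longrightarrow> u = v + 2 * (L - k)" for u v L k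
  proof (cases "k \<le> L")
    case True
    \<comment> \<open>The rule reduces to (1 - x) + x(1 - y) = 1 - xy.\<close>
    define x y where "x = q ^ (2 * (L - k))" and "y = q ^ (2 * Suc k)"
    have "2 * Suc L = 2 * (L - k) + 2 * Suc k" using True by simp
    then have "q ^ (2 * Suc L) = x * y" unfolding x_def y_def by (metis power_add)
    moreover have "q ^ u = q ^ v * x" using that True by (simp add: x_def power_add)
    ultimately show ?thesis
      unfolding q_falling_Suc[of _ L] q_falling_Suc_Suc power_mult [symmetric]
        x_def [symmetric] y_def [symmetric]
      by (simp only:) (simp add: algebra_simps)
  \<comment> \<open>For \<open>k > L\<close> all three \<open>q_falling\<close> vanish, which is why
    the exponent relation is guarded by \<open>k \<le> L\<close>.\<close>
  qed (simp add: q_falling_eq_0)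
  show ?case
  \<comment> \<open>Passing to \<open>Suc N\<close> enlarges only the supply of even exponents when
    \<open>N\<close> is even, and only that of odd exponents when \<open>N\<close> is odd.\<close>
  proof (cases "even N")
    case True
    then obtain L where N: "N = 2 * L" by blast
    show ?thesis
    proof (cases i)
      case 0
      then show ?thesis using Suc.IH[of 0 j] N by (simp add: step_even algebra_simps)
    next
      case (Suc k)
      let ?A = "q_poch (q^2) i * q_poch (q^2) j"
      define F where "F = t ^ (i + j) * q_poch_neg q N * q_falling (q^2) L j"
      have a: "P N i j * ?A = F * (q ^ wt i j * q_falling (q^2) L (Suc k))"
        using Suc.IH[of i j] by (simp add: N F_def Suc algebra_simps)
      have "t * P N k j * ?A = t * (P N k j * (q_poch (q^2) k * q_poch (q^2) j)) * (1 - q ^ (2 * Suc k))"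
        by (simp only: Suc q_poch_square_Suc mult_ac)
      also have "\<dots> = F * (q ^ wt k j * ((1 - q ^ (2 * Suc k)) * q_falling (q^2) L k))"
        unfolding Suc.IH by (simp add: N F_def Suc mult_ac)
      finally have b: "t * P N k j * ?A
          = F * (q ^ wt k j * ((1 - q ^ (2 * Suc k)) * q_falling (q^2) L k))" .
      have "P (Suc N) i j * ?A = (1 + q ^ Suc N) * (P N i j * ?A + q ^ N * (t * P N k j * ?A))"
        using True by (simp add: step_even Suc algebra_simps)
      also have "\<dots> = (1 + q ^ Suc N) * F * (q ^ wt i j * q_falling (q^2) L (Suc k)
          + q ^ (N + wt k j) * ((1 - q ^ (2 * Suc k)) * q_falling (q^2) L k))"
        unfolding a b by (simp add: power_add algebra_simps)
      \<comment> \<open>The weights of \<open>i\<close> and \<open>k\<close> differ by 2k and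
        \<open>N = 2 * L\<close>, so the exponents differ by 2(L-k), as \<open>pascal\<close> asks.
        In the odd case 2k+1 and 2L+1 give the same difference.\<close>
      also have "\<dots> = (1 + q ^ Suc N) * F * (q ^ wt i j * q_falling (q^2) (Suc L) (Suc k))"
        by (subst pascal) (use Suc N in \<open>cases k; auto simp: wt_def algebra_simps diff_mult_distrib2\<close>)+
      finally show ?thesis by (simp add: N F_def Suc algebra_simps)
    qed
  next
    case False
    then obtain L where N: "N = 2 * L + 1" using oddE by blast
    show ?thesis
    proof (cases j)
      case 0
      then show ?thesis using Suc.IH[of i 0] N by (simp add: step_odd algebra_simps)
    next
      case (Suc k)
      let ?A = "q_poch (q^2) i * q_poch (q^2) j"
      define F where "F = t ^ (i + j) * q_poch_neg q N * q_falling (q^2) (Suc L) i"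
      have a: "P N i j * ?A = F * (q ^ wt i j * q_falling (q^2) L (Suc k))"
        using Suc.IH[of i j] by (simp add: N F_def Suc algebra_simps)
      have "t * P N i k * ?A = t * (P N i k * (q_poch (q^2) i * q_poch (q^2) k)) * (1 - q ^ (2 * Suc k))"
        by (simp only: Suc q_poch_square_Suc mult_ac)
      also have "\<dots> = F * (q ^ wt i k * ((1 - q ^ (2 * Suc k)) * q_falling (q^2) L k))"
        unfolding Suc.IH by (simp add: N F_def Suc mult_ac)
      finally have b: "t * P N i k * ?A
          = F * (q ^ wt i k * ((1 - q ^ (2 * Suc k)) * q_falling (q^2) L k))" .
      have "P (Suc N) i j * ?A = (1 + q ^ Suc N) * (P N i j * ?A + q ^ N * (t * P N i k * ?A))"
        using False by (simp add: step_odd Suc algebra_simps)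
      also have "\<dots> = (1 + q ^ Suc N) * F * (q ^ wt i j * q_falling (q^2) L (Suc k)
          + q ^ (N + wt i k) * ((1 - q ^ (2 * Suc k)) * q_falling (q^2) L k))"
        unfolding a b by (simp add: power_add algebra_simps)
      also have "\<dots> = (1 + q ^ Suc N) * F * (q ^ wt i j * q_falling (q^2) (Suc L) (Suc k))"
        by (subst pascal) (use Suc N in \<open>auto simp: wt_def algebra_simps diff_mult_distrib2\<close>)+
      finally show ?thesis by (simp add: N F_def Suc algebra_simps)
    qed
  qed
qed

section \<open>Strictly decreasing lists with bounded parts\<close>

text \<open>Bounding the parts and leaving the sum free lets lists grow by prepending larger
  parts.\<close>

definition bounded_lists :: "nat \<Rightarrow> nat \<Rightarrow> nat list set" where
  "bounded_lists m B = {p. sorted_wrt (>) p \<and>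
     (\<forall>x\<in>set p. 0 < x \<and> x \<le> B \<and> \<not> [int x = - int m] (mod 3))}"

lemma bounded_lists_0: "bounded_lists m 0 = {[]}"
proof -
  have "p = []" if "p \<in> bounded_lists m 0" for p
    using that by (cases p) (auto simp: bounded_lists_def)
  then show ?thesis by (auto simp: bounded_lists_def)
qed

lemma bounded_lists_Suc:
  "bounded_lists m (Suc B) = bounded_lists m B \<union>
     (if [int (Suc B) = - int m] (mod 3) then {} else (#) (Suc B) ` bounded_lists m B)"
  (is "?L = ?R")
proof
  show "?L \<subseteq> ?R"
  proof
    fix p assume p: "p \<in> ?L"
    show "p \<in> ?R"
    proof (cases p)
      case Nil
      then show ?thesis by (auto simp: bounded_lists_def)
    next
      case (Cons x r)
      show ?thesis
      proof (cases "x = Suc B")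
        case True
        then have "r \<in> bounded_lists m B"
          using p Cons by (auto simp: bounded_lists_def less_Suc_eq_le)
        then show ?thesis using p Cons True by (auto simp: bounded_lists_def)
      next
        case False
        have lt: "y < x" if "y \<in> set r" for y
          using p Cons that by (simp add: bounded_lists_def)
        have x: "x \<le> B" using p Cons False by (simp add: bounded_lists_def)
        have "y \<le> B" if "y \<in> set p" for y
          using that Cons x by (auto dest: lt)
        then have "p \<in> bounded_lists m B"
          using p by (simp add: bounded_lists_def)
        then show ?thesis by blast
      qed
    qed
  qed
  show "?R \<subseteq> ?L"
    by (auto simp: bounded_lists_def less_Suc_eq_le intro: le_SucI split: if_splits)
qed

lemma finite_bounded_lists: "finite (bounded_lists m B)"
  by (induction B) (auto simp: bounded_lists_0 bounded_lists_Suc)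

lemma avoiding_partitions_eq:
  assumes "n \<le> B"
  shows "avoiding_partitions m n = {p \<in> bounded_lists m B. sum_list p = n}"
proof -
  have "x \<le> B" if "x \<in> set p" "sum_list p = n" for x p
    using member_le_sum_list[OF that(1)] that(2) assms by simp
  then show ?thesis
    by (auto simp: avoiding_partitions_def distinct_partition_def bounded_lists_def)
qed

section \<open>Generating functions refined by two statistics\<close>

text \<open>Over the rationals every series with nonzero constant term is a unit, so the
  denominators of the closed forms can be cancelled.\<close>

definition gf :: "(nat list \<Rightarrow> nat) \<Rightarrow> (nat list \<Rightarrow> nat) \<Rightarrow> nat \<Rightarrow> nat \<Rightarrow> nat \<Rightarrow> nat \<Rightarrow> rat fps" where
  "gf f g m B i j = (\<Sum>p\<in>{p \<in> bounded_lists m B. f p = i \<and> g p = j}. fps_X ^ sum_list p)"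

lemma gf_nth:
  "fps_nth (gf f g m B i j) n
     = of_nat (card {p \<in> bounded_lists m B. sum_list p = n \<and> f p = i \<and> g p = j})"
proof -
  let ?S = "{p \<in> bounded_lists m B. f p = i \<and> g p = j}"
  have "fps_nth (gf f g m B i j) n = (\<Sum>p\<in>?S. if n = sum_list p then 1 else 0)"
    by (simp add: gf_def fps_sum_nth fps_X_power_iff cong: sum.cong)
  also have "\<dots> = of_nat (card {p \<in> ?S. n = sum_list p})"
    using finite_bounded_lists[of m B] by (simp add: sum.If_cases Int_def)
  also have "{p \<in> ?S. n = sum_list p}
      = {p \<in> bounded_lists m B. sum_list p = n \<and> f p = i \<and> g p = j}" by auto
  finally show ?thesis .
qed

lemma gf_0: "f [] = 0 \<Longrightarrow> g [] = 0 \<Longrightarrow> gf f g m 0 i j = (if i = 0 \<and> j = 0 then 1 else 0)"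
proof -
  assume *: "f [] = 0" "g [] = 0"
  have "{p \<in> bounded_lists m 0. f p = i \<and> g p = j} = (if i = 0 \<and> j = 0 then {[]} else {})"
    using * by (auto simp: bounded_lists_0)
  then show ?thesis by (simp add: gf_def)
qed

lemma gf_skip: "[int (Suc B) = - int m] (mod 3) \<Longrightarrow> gf f g m (Suc B) i j = gf f g m B i j"
  by (simp add: gf_def bounded_lists_Suc)

text \<open>The last sum stays unevaluated because the effect of prepending depends on the
  statistics.\<close>

lemma gf_Suc:
  assumes "\<not> [int (Suc B) = - int m] (mod 3)"
  shows "gf f g m (Suc B) i j = gf f g m B i j + fps_X ^ Suc B *
    (\<Sum>p\<in>{p \<in> bounded_lists m B. f (Suc B # p) = i \<and> g (Suc B # p) = j}. fps_X ^ sum_list p)"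
proof -
  let ?S = "{p \<in> bounded_lists m B. f p = i \<and> g p = j}"
  let ?T = "{p \<in> bounded_lists m B. f (Suc B # p) = i \<and> g (Suc B # p) = j}"
  have eq: "{p \<in> bounded_lists m (Suc B). f p = i \<and> g p = j} = ?S \<union> (#) (Suc B) ` ?T"
    using assms by (auto simp: bounded_lists_Suc)
  have "?S \<inter> (#) (Suc B) ` ?T = {}"
    by (auto simp: bounded_lists_def)
  then have "gf f g m (Suc B) i j
      = gf f g m B i j + (\<Sum>p\<in>(#) (Suc B) ` ?T. fps_X ^ sum_list p)"
    unfolding gf_def eq by (intro sum.union_disjoint) (auto simp: finite_bounded_lists)
  also have "(\<Sum>p\<in>(#) (Suc B) ` ?T. fps_X ^ sum_list p)
      = (fps_X ^ Suc B * (\<Sum>p\<in>?T. fps_X ^ sum_list p) :: rat fps)"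
    by (subst sum.reindex) (auto simp: sum_distrib_left power_add mult_ac inj_on_def)
  finally show ?thesis .
qed

section \<open>Statistics on positions and parts\<close>

definition count_pos :: "(nat \<Rightarrow> nat \<Rightarrow> bool) \<Rightarrow> nat list \<Rightarrow> nat" where
  "count_pos R p = card {k \<in> {1..length p}. R k (part p k)}"

lemma count_pos_Nil [simp]: "count_pos R [] = 0"
  by (simp add: count_pos_def)

text \<open>Prepending moves every position up by one, which turns \<open>odd k\<close> into
  \<open>even k\<close> and conversely: the source of the interchange of \<open>i\<close> and
  \<open>j\<close>.\<close>

lemma count_pos_Cons:
  "count_pos R (x # p) = (if R 1 x then 1 else 0) + count_pos (\<lambda>k. R (Suc k)) p"
proof -
  let ?S = "{k \<in> {1..length p}. R (Suc k) (part p k)}"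
  \<comment> \<open>Position 0 is excluded because \<open>part p 0\<close> reads the head, by
    truncated subtraction.\<close>
  have p: "part (x # p) (Suc k) = part p k" if "k \<ge> 1" for k
    using that by (simp add: part_def nth_Cons')
  have "{k \<in> {1..length (x # p)}. R k (part (x # p) k)} = (if R 1 x then {1} else {}) \<union> Suc ` ?S"
    (is "?L = ?R")
  proof (rule set_eqI)
    fix k show "k \<in> ?L \<longleftrightarrow> k \<in> ?R"
    proof (cases k)
      case (Suc l)
      then show ?thesis using p by (cases l) (auto simp: part_def)
    qed auto
  qed
  moreover have "card (Suc ` ?S) = card ?S" by (simp add: card_image)
  ultimately show ?thesis by (auto simp: count_pos_def card_insert_if)
qed

abbreviation (input) odd_count :: "nat \<Rightarrow> nat list \<Rightarrow> nat" where
  "odd_count m \<equiv> count_pos (\<lambda>k x. odd k \<and> [x = m] (mod 3))"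

abbreviation (input) even_count :: "nat \<Rightarrow> nat list \<Rightarrow> nat" where
  "even_count m \<equiv> count_pos (\<lambda>k x. even k \<and> [x = m] (mod 3))"

abbreviation (input) mod6_count :: "nat \<Rightarrow> nat list \<Rightarrow> nat" where
  "mod6_count r \<equiv> count_pos (\<lambda>k x. [x = r] (mod 6))"

lemma D_I_eq:
  assumes "n \<le> B"
  shows "fps_nth (gf (odd_count m) (even_count m) m B i j) n = of_nat (D_I m i j n)"
  unfolding gf_nth D_I_def avoiding_partitions_eq[OF assms]
  by (rule arg_cong[of _ _ "\<lambda>S. of_nat (card S)"]) (auto simp: count_pos_def)

lemma D_II_eq:
  assumes "n \<le> B"
  shows "fps_nth (gf (mod6_count m) (mod6_count (m + 3)) m B i j) n = of_nat (D_II m i j n)"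
  unfolding gf_nth D_II_def avoiding_partitions_eq[OF assms]
  by (rule arg_cong[of _ _ "\<lambda>S. of_nat (card S)"]) (auto simp: count_pos_def)

section \<open>Recursions for one new part and for blocks of three sizes\<close>

text \<open>The new part takes position 1, which is odd. If it is congruent to \<open>m\<close>, the
  tail has odd count \<open>j\<close> and even count \<open>i - 1\<close>.\<close>

lemma gf_alternating_Suc:
  fixes m :: nat
  defines "G \<equiv> gf (odd_count m) (even_count m) m"
  assumes "\<not> [int (Suc B) = - int m] (mod 3)"
  shows "G (Suc B) i j = G B i j + fps_X ^ Suc B *
    (if [Suc B = m] (mod 3) then if i = 0 then 0 else G B j (i - 1) else G B j i)"
  unfolding G_def gf_Suc[OF assms(2)] count_pos_Cons
  by (cases i) (auto simp: gf_def conj_commute)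

lemma gf_residue_Suc:
  fixes m :: nat
  defines "G \<equiv> gf (mod6_count m) (mod6_count (m + 3)) m"
  assumes "\<not> [int (Suc B) = - int m] (mod 3)"
  shows "G (Suc B) i j = G B i j + fps_X ^ Suc B *
    (if [Suc B = m] (mod 6) then if i = 0 then 0 else G B (i - 1) j
     else if [Suc B = m + 3] (mod 6) then if j = 0 then 0 else G B i (j - 1) else G B i j)"
proof -
  have "\<not> ([Suc B = m] (mod 6) \<and> [Suc B = m + 3] (mod 6))"
  proof
    assume "[Suc B = m] (mod 6) \<and> [Suc B = m + 3] (mod 6)"
    then have "[m + 3 = m + 0] (mod 6)" by (metis add_0_right cong_sym cong_trans)
    then show False by (simp only: cong_add_lcancel_nat) (simp add: cong_def)
  qed
  then show ?thesis
    unfolding G_def gf_Suc[OF assms(2)] count_pos_Cons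
    by (cases i; cases j) (auto simp: gf_def)
qed

lemma cong_uminus_iff_dvd: "[int a = - int b] (mod int k) \<longleftrightarrow> k dvd a + b"
proof -
  have "int a - - int b = int (a + b)" by simp
  then show ?thesis by (simp only: cong_iff_dvd_diff int_dvd_int_iff)
qed

text \<open>This decides which of the two counts the part 3N+m raises.\<close>

lemma mult_3_cong_mod_6:
  fixes m N :: nat
  shows "[3 * N + m = m] (mod 6) \<longleftrightarrow> even N" "[3 * N + m = m + 3] (mod 6) \<longleftrightarrow> odd N"
proof -
  have "3 * N mod 6 = 3 * (N mod 2)" using mult_mod_right[of 3 N 2] by simp
  then have "3 * N mod 6 = (if even N then 0 else 3)" by (simp add: mod_2_eq_odd)
  then show "[3 * N + m = m] (mod 6) \<longleftrightarrow> even N" "[3 * N + m = m + 3] (mod 6) \<longleftrightarrow> odd N"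
    unfolding add.commute[of m 3] cong_add_rcancel_0_nat cong_add_rcancel_nat
    by (simp_all add: cong_def)
qed

text \<open>For \<open>m\<close> equal to 1 or 2 this keeps multiples of 3 out of both
  classes.\<close>

lemma cong_mod_6_dvd_3:
  fixes a m :: nat
  assumes "[a = m] (mod 6) \<or> [a = m + 3] (mod 6)"
  shows "3 dvd a \<longleftrightarrow> 3 dvd m"
proof -
  have "[a = m] (mod 3) \<or> [a = m + 3] (mod 3)"
    using assms cong_dvd_modulus_nat[of a _ 6 3] by auto
  then show ?thesis by (auto dest!: cong_dvd_iff)
qed

text \<open>Of the sizes 3N+1, 3N+2, 3N+3, the part 3N+m is counted, 3N+3 only interchanges the
  counts, and the third is forbidden.\<close>

lemma gf_alternating_block:
  fixes m :: nat
  defines "G \<equiv> gf (odd_count m) (even_count m) m"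
  defines "q \<equiv> fps_X ^ 3" and "t \<equiv> fps_X ^ m"
  assumes "m \<in> {1, 2}"
  shows "G (3 * Suc N) i j = G (3 * N) i j + t * q ^ N * (if i = 0 then 0 else G (3 * N) j (i - 1))
    + q ^ Suc N * (G (3 * N) j i + t * q ^ N * (if j = 0 then 0 else G (3 * N) i (j - 1)))"
proof -
  from assms have m: "m = 1 \<or> m = 2" by simp
  note c = cong_uminus_iff_dvd[where k = 3, simplified of_nat_numeral]
  \<comment> \<open>The forbidden size is 3N+2 for \<open>m = 1\<close> and 3N+1 for
    \<open>m = 2\<close>. The claim is general in \<open>i\<close> and \<open>j\<close> because the
    part 3N+3 applies it also to the interchanged pair.\<close>
  have colored: "G (3 * N + 2) i j = G (3 * N) i j + t * q ^ N * (if i = 0 then 0 else G (3 * N) j (i - 1))"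
    for i j
  proof (cases "m = 1")
    case True
    have "G (Suc (Suc (3 * N))) i j = G (Suc (3 * N)) i j"
      unfolding G_def by (rule gf_skip, subst c) (use True in \<open>auto simp: dvd_eq_mod_eq_0 mod_Suc\<close>)
    also have "\<dots> = G (3 * N) i j + fps_X ^ Suc (3 * N) * (if i = 0 then 0 else G (3 * N) j (i - 1))"
    proof -
      have "\<not> [int (Suc (3 * N)) = - int m] (mod 3)" by (subst c) (use True in \<open>auto simp: dvd_eq_mod_eq_0 mod_Suc\<close>)
      note eq = gf_alternating_Suc[OF this, of i j]
      have "[Suc (3 * N) = m] (mod 3)" using True by (simp add: cong_def mod_Suc)
      then show ?thesis using eq unfolding G_def by (simp only: if_True if_False)
    qed
    finally show ?thesis by (simp add: q_def t_def True power_mult)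
  next
    case False
    with m have m2: "m = 2" by simp
    have "G (Suc (Suc (3 * N))) i j = G (Suc (3 * N)) i j
       + fps_X ^ Suc (Suc (3 * N)) * (if i = 0 then 0 else G (Suc (3 * N)) j (i - 1))"
    proof -
      have "\<not> [int (Suc (Suc (3 * N))) = - int m] (mod 3)" by (subst c) (use m2 in \<open>auto simp: dvd_eq_mod_eq_0 mod_Suc\<close>)
      note eq = gf_alternating_Suc[OF this, of i j]
      have "[Suc (Suc (3 * N)) = m] (mod 3)" using m2 by (simp add: cong_def mod_Suc)
      then show ?thesis using eq unfolding G_def by (simp only: if_True if_False)
    qed
    moreover have "G (Suc (3 * N)) i j = G (3 * N) i j" for i j
      unfolding G_def by (rule gf_skip, subst c) (use m2 in \<open>auto simp: dvd_eq_mod_eq_0 mod_Suc\<close>)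
    ultimately show ?thesis by (simp add: q_def t_def m2 power_mult power2_eq_square)
  qed
  have "G (Suc (3 * N + 2)) i j = G (3 * N + 2) i j + fps_X ^ Suc (3 * N + 2) * G (3 * N + 2) j i"
  proof -
    have "\<not> [int (Suc (3 * N + 2)) = - int m] (mod 3)" by (subst c) (use m in \<open>auto simp: dvd_eq_mod_eq_0 mod_Suc\<close>)
    note eq = gf_alternating_Suc[OF this, of i j]
    have "\<not> [Suc (3 * N + 2) = m] (mod 3)" using m by (auto simp: cong_def mod_Suc)
    then show ?thesis using eq unfolding G_def by (simp only: if_True if_False)
  qed
  moreover have s: "Suc (3 * N + 2) = 3 * Suc N" by simp
  ultimately show ?thesis unfolding s power_mult q_def [symmetric] colored by blast
qed

text \<open>Here 3N+3 changes neither count, so it contributes the factor 1 + q^(N+1).\<close>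

lemma gf_residue_block:
  fixes m :: nat
  defines "G \<equiv> gf (mod6_count m) (mod6_count (m + 3)) m"
  defines "q \<equiv> fps_X ^ 3" and "t \<equiv> fps_X ^ m"
  assumes "m \<in> {1, 2}"
  shows "G (3 * Suc N) i j = (1 + q ^ Suc N) * (G (3 * N) i j + t * q ^ N *
    (if even N then if i = 0 then 0 else G (3 * N) (i - 1) j
     else if j = 0 then 0 else G (3 * N) i (j - 1)))"
proof -
  from assms have m: "m = 1 \<or> m = 2" by simp
  note c = cong_uminus_iff_dvd[where k = 3, simplified of_nat_numeral]
  let ?C = "\<lambda>B. if even N then if i = 0 then 0 else G B (i - 1) j
     else if j = 0 then 0 else G B i (j - 1)"
  have colored: "G (3 * N + 2) i j = G (3 * N) i j + t * q ^ N * ?C (3 * N)"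
  proof (cases "m = 1")
    case True
    have "G (Suc (Suc (3 * N))) i j = G (Suc (3 * N)) i j"
      unfolding G_def by (rule gf_skip, subst c) (use True in \<open>auto simp: dvd_eq_mod_eq_0 mod_Suc\<close>)
    also have "\<dots> = G (3 * N) i j + fps_X ^ Suc (3 * N) * ?C (3 * N)"
    proof -
      have "\<not> [int (Suc (3 * N)) = - int m] (mod 3)" by (subst c) (use True in \<open>auto simp: dvd_eq_mod_eq_0 mod_Suc\<close>)
      note eq = gf_residue_Suc[OF this, of i j]
      have "Suc (3 * N) = 3 * N + m" using True by simp
      note r = mult_3_cong_mod_6[of N m, folded this]
      show ?thesis using eq unfolding G_def r by (cases "even N") simp_all
    qed
    finally show ?thesis by (simp add: q_def t_def True power_mult)
  next
    case False
    with m have m2: "m = 2" by simp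
    have "G (Suc (Suc (3 * N))) i j = G (Suc (3 * N)) i j
       + fps_X ^ Suc (Suc (3 * N)) * ?C (Suc (3 * N))"
    proof -
      have "\<not> [int (Suc (Suc (3 * N))) = - int m] (mod 3)" by (subst c) (use m2 in \<open>auto simp: dvd_eq_mod_eq_0 mod_Suc\<close>)
      note eq = gf_residue_Suc[OF this, of i j]
      have "Suc (Suc (3 * N)) = 3 * N + m" using m2 by simp
      note r = mult_3_cong_mod_6[of N m, folded this]
      show ?thesis using eq unfolding G_def r by (cases "even N") simp_all
    qed
    moreover have "G (Suc (3 * N)) i j = G (3 * N) i j" for i j
      unfolding G_def by (rule gf_skip, subst c) (use m2 in \<open>auto simp: dvd_eq_mod_eq_0 mod_Suc\<close>)
    ultimately show ?thesis by (simp add: q_def t_def m2 power_mult power2_eq_square)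
  qed
  have "3 dvd Suc (3 * N + 2)" "\<not> 3 dvd m"
    using m by (auto simp: dvd_eq_mod_eq_0 mod_Suc)
  then have "\<not> [Suc (3 * N + 2) = m] (mod 6)" "\<not> [Suc (3 * N + 2) = m + 3] (mod 6)"
    using cong_mod_6_dvd_3[of "Suc (3 * N + 2)" m] by auto
  moreover have "\<not> 3 dvd (Suc (3 * N + 2) + m)" using m by (auto simp: dvd_eq_mod_eq_0 mod_Suc)
  ultimately have "G (Suc (3 * N + 2)) i j
      = G (3 * N + 2) i j + fps_X ^ Suc (3 * N + 2) * G (3 * N + 2) i j"
    unfolding G_def by (simp only: gf_residue_Suc c if_False not_False_eq_True)
  moreover have s: "Suc (3 * N + 2) = 3 * Suc N" by simp
  ultimately show ?thesis
    unfolding s power_mult q_def [symmetric] colored by (simp only: distrib_right mult_1_left)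
qed

section \<open>Comparison of coefficients\<close>

theorem theorem3p6:
  fixes n i j m :: nat
  assumes "m \<in> {1, 2}"
  shows "D_I m i j n = D_II m i j n"
proof -
  \<comment> \<open>This size makes every exponent in the truncation factors exceed
    \<open>n\<close>. The even truncation \<open>2 * L\<close> gives both residue classes
    \<open>L\<close> exponents.\<close>
  define L where "L = n + i + j + 1"
  define q t :: "rat fps" where "q = fps_X ^ 3" and "t = fps_X ^ m"
  define G where "G = gf (odd_count m) (even_count m) m (3 * (2 * L)) i j"
  define H where "H = gf (mod6_count m) (mod6_count (m + 3)) m (3 * (2 * L)) i j"
  define A where "A = q_poch (q^2) i * q_poch (q^2) j"
  define T where "T = t ^ (i + j) * q ^ wt i j * q_poch_neg q (2 * L)"
  let ?d = "fps_X ^ Suc n :: rat fps"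
  have G: "G * A = T * q_falling q (2 * L) (i + j)"
    unfolding G_def A_def T_def
    by (rule alternating_closed_form[where P = "\<lambda>N. gf (odd_count m) (even_count m) m (3 * N)"])
      (simp add: gf_0, simp only: gf_alternating_block[OF assms] q_def t_def)
  have H: "H * A = T * (q_falling (q^2) L i * q_falling (q^2) L j)"
    using residue_closed_form[where N = "2 * L" and q = q and t = t and i = i and j = j and
        P = "\<lambda>N. gf (mod6_count m) (mod6_count (m + 3)) m (3 * N)"]
    unfolding H_def A_def T_def q_def t_def by (simp add: gf_0 gf_residue_block[OF assms] del: mult_Suc_right)
  have pow: "?d dvd q ^ k" if "n < k" for k
    unfolding q_def power_mult [symmetric] by (rule le_imp_power_dvd) (use that in simp)
  have "?d dvd q_falling q (2 * L) (i + j) - 1"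
    by (rule q_falling_cong_1, rule pow) (simp add: L_def)
  moreover have "?d dvd q_falling (q^2) L i - 1"
    by (rule q_falling_cong_1, unfold power_mult [symmetric], rule pow) (simp add: L_def)
  moreover have "?d dvd q_falling (q^2) L j - 1"
    by (rule q_falling_cong_1, unfold power_mult [symmetric], rule pow) (simp add: L_def)
  \<comment> \<open>With a, b, c the three \<open>q_falling\<close> products, a - bc = (a - 1) - (b
    - 1)c - (c - 1).\<close>
  ultimately have "?d dvd T * ((q_falling q (2 * L) (i + j) - 1)
      - (q_falling (q^2) L i - 1) * q_falling (q^2) L j - (q_falling (q^2) L j - 1))"
    by (simp only: dvd_diff dvd_mult dvd_mult2)
  also have "\<dots> = (G - H) * A"
    using G H by (simp add: algebra_simps)
  finally have "?d dvd (G - H) * A" .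
  \<comment> \<open>\<open>A\<close> has constant term 1, so it can be cancelled from the
    divisibility.\<close>
  moreover have "A dvd 1"
  proof -
    have "fps_nth (q_poch (q^2) k) 0 = 1" for k
      by (induction k) (simp_all add: q_def)
    then show ?thesis by (simp add: A_def fps_is_unit_iff)
  qed
  ultimately have "?d dvd G - H"
    by (simp add: dvd_mult_unit_iff)
  then obtain R where "G - H = ?d * R" ..
  then have "fps_nth (G - H) n = 0"
    by (simp only: fps_X_power_mult_nth) simp
  moreover have "n \<le> 3 * (2 * L)" by (simp add: L_def)
  ultimately have "(of_nat (D_I m i j n) :: rat) = of_nat (D_II m i j n)"
    using D_I_eq[of n "3 * (2 * L)" m i j] D_II_eq[of n "3 * (2 * L)" m i j]
    by (simp add: G_def H_def)
  then show ?thesis by simp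
qed

end
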